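(* Let $n\ge4$ and $d\ge4$ be integers and let $\tilde e=(0,0,1,1,0,\ldots,0)\in\mathbb{R}^n$. Then there exists a polynomial $p\in\mathcal{H}_{n,d}(\tilde e)$ that is not SOS-hyperbolic with respect to $\tilde e$.
   Context: A homogeneous polynomial $p\in\mathbb{R}[x_1,\ldots,x_n]$ of degree $d$ is hyperbolic with respect to $e\in\mathbb{R}^n$ if $p(e)>0$ and for every $x\in\mathbb{R}^n$ the polynomial $t\mapsto p(x+te)$ has only real zeros; $\mathcal{H}_{n,d}(e)$ is the set of such polynomials. The hyperbolicity cone $\Lambda_+(p,e)$ is the set of $x\in\mathbb{R}^n$ such that all zeros of $t\mapsto p(te-x)$ are nonnegative. For $x,u\in\mathbb{R}^n$ put $p_x(t)=p(x+te)$ and $D_up_x(t)=(D_up)(x+te)$, with $D_u$ the directional derivative. The parameterized Bézoutian $B_{p,e}(x)[u]$ is the $d\times d$ symmetric matrix (with entries polynomial in $x$) defined by $$\frac{p_x(t)\,D_up_x(s)-D_up_x(t)\,p_x(s)}{t-s}=\sum_{i,j=1}^d [B_{p,e}(x)[u]]_{ij}\,t^{i-1}s^{j-1}.$$ A symmetric matrix $P(x)$ with polynomial entries is a matrix sum of squares if $P(x)=Q(x)Q(x)^T$ for some (possibly rectangular) matrix $Q$ with real polynomial entries. $p\in\mathcal{H}_{n,d}(e)$ is SOS-hyperbolic with respect to $e$ if $B_{p,e}(x)[u]$ is a matrix sum of squares for every $u\in\Lambda_+(p,e)$. *)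

theory Defs
  imports
    "HOL-Analysis.Analysis"
    "HOL-Library.Poly_Mapping"
    "HOL-Computational_Algebra.Polynomial"
    "Jordan_Normal_Form.Matrix"
begin

text \<open>
  A real polynomial in countably many variables is a finitely supported map from monomials
  (finitely supported exponent maps) to coefficients; multiplication is convolution.
  Variables are numbered from 0, so the ring of polynomials in \<open>n\<close> variables consists of the
  polynomials in which only variables with index below \<open>n\<close> occur.
\<close>

type_synonym real_mpoly = "(nat \<Rightarrow>\<^sub>0 nat) \<Rightarrow>\<^sub>0 real"

definition mpolys :: "nat \<Rightarrow> real_mpoly set" where
  "mpolys n = {p. \<forall>m\<in>Poly_Mapping.keys p. Poly_Mapping.keys m \<subseteq> {..<n}}"

definition homogeneous_mpolys :: "nat \<Rightarrow> nat \<Rightarrow> real_mpoly set" where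
  "homogeneous_mpolys n d = {p \<in> mpolys n. \<forall>m\<in>Poly_Mapping.keys p. (\<Sum>i\<in>Poly_Mapping.keys m. Poly_Mapping.lookup m i) = d}"

text \<open>Substitution of \<open>v i\<close> for the \<open>i\<close>-th variable, with values in an algebra over the reals whose
  structure map is \<open>h\<close>.\<close>

definition subst_mpoly :: "(real \<Rightarrow> 'r) \<Rightarrow> (nat \<Rightarrow> 'r) \<Rightarrow> real_mpoly \<Rightarrow> 'r::comm_semiring_1" where
  "subst_mpoly h v p = (\<Sum>m\<in>Poly_Mapping.keys p. h (Poly_Mapping.lookup p m) * (\<Prod>i\<in>Poly_Mapping.keys m. v i ^ Poly_Mapping.lookup m i))"

definition eval_mpoly :: "real_mpoly \<Rightarrow> real vec \<Rightarrow> real" where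
  "eval_mpoly p x = subst_mpoly (\<lambda>c. c) (\<lambda>i. x $ i) p"

text \<open>The univariate polynomial \<open>p\<^sub>x(t) = p(x + t e)\<close>.\<close>

definition line_poly :: "real_mpoly \<Rightarrow> real vec \<Rightarrow> real vec \<Rightarrow> real poly" where
  "line_poly p e x = subst_mpoly (\<lambda>c. [:c:]) (\<lambda>i. [:x $ i, e $ i:]) p"

text \<open>Where \<open>Poly_Mapping.lookup m i = 0\<close> the exponent subtraction truncates, but then the coefficient is 0.\<close>

definition partial_mpoly :: "nat \<Rightarrow> real_mpoly \<Rightarrow> real_mpoly" where
  "partial_mpoly i p =
     (\<Sum>m\<in>Poly_Mapping.keys p. Poly_Mapping.single (m - Poly_Mapping.single i 1) (Poly_Mapping.lookup p m * real (Poly_Mapping.lookup m i)))"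

definition dir_deriv :: "nat \<Rightarrow> real vec \<Rightarrow> real_mpoly \<Rightarrow> real_mpoly" where
  "dir_deriv n u p = (\<Sum>i<n. Poly_Mapping.single 0 (u $ i) * partial_mpoly i p)"

text \<open>Having only real zeros is a condition on the complex zeros of the real polynomial.\<close>

definition hyperbolic_mpolys :: "nat \<Rightarrow> nat \<Rightarrow> real vec \<Rightarrow> real_mpoly set" where
  "hyperbolic_mpolys n d e =
     {p \<in> homogeneous_mpolys n d. eval_mpoly p e > 0 \<and>
        (\<forall>x\<in>carrier_vec n. \<forall>z::complex.
           poly (map_poly complex_of_real (line_poly p e x)) z = 0 \<longrightarrow> z \<in> \<real>)}"

text \<open>Only used for \<open>p\<close> hyperbolic with respect to \<open>e\<close>, where all zeros in question are real.\<close>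

definition hyperbolicity_cone :: "nat \<Rightarrow> real_mpoly \<Rightarrow> real vec \<Rightarrow> real vec set" where
  "hyperbolicity_cone n p e =
     {x \<in> carrier_vec n. \<forall>t::real. eval_mpoly p (t \<cdot>\<^sub>v e - x) = 0 \<longrightarrow> 0 \<le> t}"

text \<open>
  The quotient \<open>(f(t) g(s) - g(t) f(s)) / (t - s)\<close> as a polynomial in \<open>t\<close> whose coefficients are
  polynomials in \<open>s\<close>. The division is exact.
\<close>

definition bezout_quotient :: "real poly \<Rightarrow> real poly \<Rightarrow> real poly poly" where
  "bezout_quotient f g =
     (map_poly (\<lambda>c. [:c:]) f * [:g:] - map_poly (\<lambda>c. [:c:]) g * [:f:]) div [:- [:0, 1:], 1:]"

text \<open>With 0-based indices the \<open>(i, j)\<close> entry is the coefficient of \<open>t\<^sup>i s\<^sup>j\<close>.\<close>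

definition bezoutian :: "nat \<Rightarrow> nat \<Rightarrow> real_mpoly \<Rightarrow> real vec \<Rightarrow> real vec \<Rightarrow> real vec \<Rightarrow> real mat" where
  "bezoutian n d p e u x =
     mat d d (\<lambda>(i, j).
       coeff (coeff (bezout_quotient (line_poly p e x) (line_poly (dir_deriv n u p) e x)) i) j)"

text \<open>A matrix with polynomial entries is given here as the function sending a point to the matrix of
  values; over the reals, polynomial identities are identities of functions.\<close>

definition matrix_sos :: "nat \<Rightarrow> nat \<Rightarrow> (real vec \<Rightarrow> real mat) \<Rightarrow> bool" where
  "matrix_sos n d P \<longleftrightarrow>
     (\<exists>k. \<exists>Q\<in>carrier_mat d k. elements_mat Q \<subseteq> mpolys n \<and>
        (\<forall>x\<in>carrier_vec n.
           P x = map_mat (\<lambda>q. eval_mpoly q x) Q * transpose_mat (map_mat (\<lambda>q. eval_mpoly q x) Q)))"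

definition sos_hyperbolic :: "nat \<Rightarrow> nat \<Rightarrow> real_mpoly \<Rightarrow> real vec \<Rightarrow> bool" where
  "sos_hyperbolic n d p e \<longleftrightarrow>
     p \<in> hyperbolic_mpolys n d e \<and>
     (\<forall>u\<in>hyperbolicity_cone n p e. matrix_sos n d (bezoutian n d p e u))"

definition e_tilde :: "nat \<Rightarrow> real vec" where
  "e_tilde n = vec n (\<lambda>i. if i = 2 \<or> i = 3 then 1 else 0)"

text \<open>Consistency checks: the definitions have the expected defining properties.\<close>

lemma poly_line_poly:
  assumes "p \<in> mpolys n" "e \<in> carrier_vec n" "x \<in> carrier_vec n"
  shows "poly (line_poly p e x) t = eval_mpoly p (x + t \<cdot>\<^sub>v e)"
proof -
  have "(\<Prod>i\<in>Poly_Mapping.keys m. poly [:x $ i, e $ i:] t ^ Poly_Mapping.lookup m i) =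
        (\<Prod>i\<in>Poly_Mapping.keys m. (x + t \<cdot>\<^sub>v e) $ i ^ Poly_Mapping.lookup m i)" if "m \<in> Poly_Mapping.keys p" for m
    using that assms by (intro prod.cong) (auto simp: mpolys_def subset_iff)
  then show ?thesis
    by (simp add: line_poly_def eval_mpoly_def subst_mpoly_def poly_sum poly_prod)
qed

lemma subst_mpoly_eq_sum:
  assumes "finite A" "Poly_Mapping.keys p \<subseteq> A" "h 0 = 0"
  shows "subst_mpoly h v p = (\<Sum>m\<in>A. h (Poly_Mapping.lookup p m) * (\<Prod>i\<in>Poly_Mapping.keys m. v i ^ Poly_Mapping.lookup m i))"
  unfolding subst_mpoly_def using assms
  by (intro sum.mono_neutral_left) (auto simp: in_keys_iff)

lemma subst_mpoly_add:
  assumes "\<And>a b. h (a + b) = h a + h b" "h 0 = 0"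
  shows "subst_mpoly h v (p + q) = subst_mpoly h v p + subst_mpoly h v q"
proof -
  have "finite (Poly_Mapping.keys p \<union> Poly_Mapping.keys q)" by simp
  note eq = subst_mpoly_eq_sum[of "Poly_Mapping.keys p \<union> Poly_Mapping.keys q" _ h, OF this _ assms(2)]
  show ?thesis
    using Poly_Mapping.keys_add[of p q]
    by (simp add: eq lookup_add assms distrib_right sum.distrib)
qed

lemma subst_mpoly_sum:
  assumes "\<And>a b. h (a + b) = h a + h b" "h 0 = 0"
  shows "subst_mpoly h v (sum f A) = (\<Sum>a\<in>A. subst_mpoly h v (f a))"
proof (induction A rule: infinite_finite_induct)
  case (insert a A)
  then show ?case by (simp add: subst_mpoly_add[of h, OF assms])
qed (simp_all add: subst_mpoly_def)

lemma subst_mpoly_single: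
  assumes "h 0 = 0"
  shows "subst_mpoly h v (Poly_Mapping.single m c) = h c * (\<Prod>i\<in>Poly_Mapping.keys m. v i ^ Poly_Mapping.lookup m i)"
  by (cases "c = 0") (auto simp: subst_mpoly_def assms)

text \<open>The formal directional derivative is the analytic one.\<close>

lemma partial_monomial:
  fixes x :: "real vec"
  shows "real (Poly_Mapping.lookup m i) * (\<Prod>j\<in>Poly_Mapping.keys (m - Poly_Mapping.single i 1). x $ j ^ Poly_Mapping.lookup (m - Poly_Mapping.single i 1) j)
     = real (Poly_Mapping.lookup m i) * x $ i ^ (Poly_Mapping.lookup m i - 1) * (\<Prod>j\<in>Poly_Mapping.keys m - {i}. x $ j ^ Poly_Mapping.lookup m j)"
proof (cases "i \<in> Poly_Mapping.keys m")
  case True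
  have sub: "Poly_Mapping.keys (m - Poly_Mapping.single i 1) \<subseteq> Poly_Mapping.keys m"
    by (auto simp: in_keys_iff lookup_minus)
  have "(\<Prod>j\<in>Poly_Mapping.keys (m - Poly_Mapping.single i 1). x $ j ^ Poly_Mapping.lookup (m - Poly_Mapping.single i 1) j)
      = (\<Prod>j\<in>Poly_Mapping.keys m. x $ j ^ Poly_Mapping.lookup (m - Poly_Mapping.single i 1) j)"
    using sub by (intro prod.mono_neutral_left) (auto simp: in_keys_iff)
  also have "\<dots> = x $ i ^ (Poly_Mapping.lookup m i - 1) *
      (\<Prod>j\<in>Poly_Mapping.keys m - {i}. x $ j ^ Poly_Mapping.lookup (m - Poly_Mapping.single i 1) j)"
    using True by (subst prod.remove[of _ i]) (auto simp: lookup_minus)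
  also have "(\<Prod>j\<in>Poly_Mapping.keys m - {i}. x $ j ^ Poly_Mapping.lookup (m - Poly_Mapping.single i 1) j)
      = (\<Prod>j\<in>Poly_Mapping.keys m - {i}. x $ j ^ Poly_Mapping.lookup m j)"
    by (intro prod.cong) (auto simp: lookup_minus lookup_single when_def)
  finally show ?thesis by simp
qed (simp add: in_keys_iff)

lemma eval_partial_mpoly:
  "eval_mpoly (partial_mpoly i p) x =
     (\<Sum>m\<in>Poly_Mapping.keys p. Poly_Mapping.lookup p m *
        (real (Poly_Mapping.lookup m i) * x $ i ^ (Poly_Mapping.lookup m i - 1) * (\<Prod>j\<in>Poly_Mapping.keys m - {i}. x $ j ^ Poly_Mapping.lookup m j)))"
  unfolding eval_mpoly_def partial_mpoly_def
  by (subst subst_mpoly_sum, simp, simp, intro sum.cong refl)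
     (simp only: subst_mpoly_single mult.assoc partial_monomial[unfolded mult.assoc])

lemma eval_mpoly_scale:
  "eval_mpoly (Poly_Mapping.single 0 c * q) x = c * eval_mpoly q x"
proof -
  have scale: "Poly_Mapping.map ((*) c) q = Poly_Mapping.single 0 c * q"
    by (rule mult_map_scale_conv_mult)
  have l: "Poly_Mapping.lookup (Poly_Mapping.map ((*) c) q) m = c * Poly_Mapping.lookup q m" for m
    by (simp add: Poly_Mapping.map.rep_eq when_def)
  have "Poly_Mapping.keys (Poly_Mapping.map ((*) c) q) \<subseteq> Poly_Mapping.keys q"
    by (auto simp: in_keys_iff l)
  then show ?thesis
    unfolding eval_mpoly_def scale[symmetric]
    by (subst subst_mpoly_eq_sum[of "Poly_Mapping.keys q"])
       (simp_all add: l subst_mpoly_def sum_distrib_left mult.assoc)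
qed

lemma has_derivative_dir_deriv:
  assumes "p \<in> mpolys n" "u \<in> carrier_vec n" "x \<in> carrier_vec n"
  shows "((\<lambda>t. eval_mpoly p (x + t \<cdot>\<^sub>v u)) has_real_derivative eval_mpoly (dir_deriv n u p) x) (at 0)"
proof -
  have less: "i < n" if "m \<in> Poly_Mapping.keys p" "i \<in> Poly_Mapping.keys m" for m i
    using that assms(1) by (auto simp: mpolys_def)
  have eq: "eval_mpoly p (x + t \<cdot>\<^sub>v u) =
      (\<Sum>m\<in>Poly_Mapping.keys p. Poly_Mapping.lookup p m * (\<Prod>i\<in>Poly_Mapping.keys m. (x $ i + t * u $ i) ^ Poly_Mapping.lookup m i))" for t
    unfolding eval_mpoly_def subst_mpoly_def
    using assms(2,3) by (intro sum.cong prod.cong arg_cong2[of _ _ _ _ "(*)"] refl) (auto dest: less)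
  have der: "((\<lambda>t. \<Prod>i\<in>Poly_Mapping.keys m. (x $ i + t * u $ i) ^ Poly_Mapping.lookup m i) has_real_derivative
      (\<Sum>i\<in>Poly_Mapping.keys m. real (Poly_Mapping.lookup m i) * x $ i ^ (Poly_Mapping.lookup m i - 1) * u $ i *
         (\<Prod>j\<in>Poly_Mapping.keys m - {i}. x $ j ^ Poly_Mapping.lookup m j))) (at 0)" for m
  proof -
    have "((\<lambda>t. (x $ i + t * u $ i) ^ Poly_Mapping.lookup m i) has_real_derivative
        real (Poly_Mapping.lookup m i) * x $ i ^ (Poly_Mapping.lookup m i - 1) * u $ i) (at 0)" for i
      by (auto intro!: derivative_eq_intros)
    then have "((\<lambda>t. \<Prod>i\<in>Poly_Mapping.keys m. (x $ i + t * u $ i) ^ Poly_Mapping.lookup m i) has_real_derivative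
      (\<Sum>i\<in>Poly_Mapping.keys m. real (Poly_Mapping.lookup m i) * x $ i ^ (Poly_Mapping.lookup m i - 1) * u $ i *
         (\<Prod>j\<in>Poly_Mapping.keys m - {i}. (x $ j + 0 * u $ j) ^ Poly_Mapping.lookup m j))) (at 0)"
      by (intro has_field_derivative_prod)
    then show ?thesis by simp
  qed
  have "eval_mpoly (dir_deriv n u p) x = (\<Sum>i<n. u $ i * eval_mpoly (partial_mpoly i p) x)"
    unfolding dir_deriv_def eval_mpoly_def
    by (subst subst_mpoly_sum) (simp_all add: eval_mpoly_scale[unfolded eval_mpoly_def])
  also have "\<dots> = (\<Sum>m\<in>Poly_Mapping.keys p. Poly_Mapping.lookup p m * (\<Sum>i<n. real (Poly_Mapping.lookup m i) * x $ i ^ (Poly_Mapping.lookup m i - 1) * u $ i *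
         (\<Prod>j\<in>Poly_Mapping.keys m - {i}. x $ j ^ Poly_Mapping.lookup m j)))"
    unfolding eval_partial_mpoly sum_distrib_left
    by (subst sum.swap) (simp add: ac_simps)
  also have "\<dots> = (\<Sum>m\<in>Poly_Mapping.keys p. Poly_Mapping.lookup p m * (\<Sum>i\<in>Poly_Mapping.keys m. real (Poly_Mapping.lookup m i) * x $ i ^ (Poly_Mapping.lookup m i - 1) * u $ i *
         (\<Prod>j\<in>Poly_Mapping.keys m - {i}. x $ j ^ Poly_Mapping.lookup m j)))"
    by (intro sum.cong arg_cong2[of _ _ _ _ "(*)"] refl sum.mono_neutral_right)
       (auto simp: in_keys_iff intro: less)
  finally show ?thesis
    unfolding eq by (simp only:) (intro DERIV_sum DERIV_cmult der)
qed

text \<open>The defining identity of the Bezoutian.\<close>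

lemma bezout_quotient_mult:
  "bezout_quotient f g * [:- [:0, 1:], 1:] =
     map_poly (\<lambda>c. [:c:]) f * [:g:] - map_poly (\<lambda>c. [:c:]) g * [:f:]"
proof -
  have "poly (map_poly (\<lambda>c. [:c:]) q) [:0, 1:] = q" for q :: "real poly"
    by (induction q) (auto simp: map_poly_pCons)
  then have "poly (map_poly (\<lambda>c. [:c:]) f * [:g:] - map_poly (\<lambda>c. [:c:]) g * [:f:]) [:0, 1:] = 0"
    by (simp add: mult.commute)
  then have "[:- [:0, 1:], 1:] dvd map_poly (\<lambda>c. [:c:]) f * [:g:] - map_poly (\<lambda>c. [:c:]) g * [:f:]"
    by (simp only: poly_eq_0_iff_dvd)
  then show ?thesis
    unfolding bezout_quotient_def by (rule dvd_div_mult_self)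
qed

end

theory Submission
  imports Defs
begin

text \<open>
  Write \<open>e\<^sub>j\<close> for the elementary symmetric polynomials in four variables \<open>a, b, c, d\<close>. The witness is
  \<open>v d\<^sup>k\<close> with \<open>k\<close> four less than the required degree, where
  \<open>v = c\<^sup>2 d\<^sup>2 + 4 e\<^sub>1 e\<^sub>3\<close> is the specialized Vamos polynomial; any further variables do not occur in it.
  The direction of hyperbolicity increases \<open>c\<close> and \<open>d\<close> simultaneously.

  Hyperbolicity (lemma \<open>real_rooted_vamos_line\<close>). With \<open>s = a + b\<close>, \<open>q = (a - b)\<^sup>2\<close>, \<open>D = ((c - d)/2)\<^sup>2\<close>,
  which are constant on a line, and \<open>\<tau> = (c + d)/2\<close> as the line parameter, the restriction of \<open>v\<close> is the
  monic quartic \<open>(\<tau>\<^sup>2 - D + 2s(s + 2\<tau>))\<^sup>2 - 2(s + 2\<tau>)(2s\<^sup>3 + (3s\<^sup>2 + q)\<tau>)\<close>. It is nonnegative at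
  \<open>\<tau> = -s/2\<close>. If \<open>s \<noteq> 0\<close>, it takes values \<open>\<le> 0\<close> on both sides of that point, at \<open>0\<close> or at zeros of the
  squared expression; if \<open>s = 0\<close>, it does so at \<open>\<tau> = \<plusminus>\<surd>(D + q)\<close> unless it is \<open>\<tau>\<^sup>4\<close>. By the
  intermediate value theorem a quartic with this sign pattern has only real zeros.

  Failure of the sum of squares property (lemma \<open>vamos_wronskian_not_sos\<close>). The unit vector \<open>u\<close> of
  the variable \<open>c\<close> lies in the hyperbolicity cone. The upper left entry of the Bezoutian of a
  polynomial \<open>p\<close> is \<open>D\<^sub>e p D\<^sub>u p - p D\<^sub>e D\<^sub>u p\<close>, so if the Bezoutian were a matrix sum of squares, this
  polynomial would be a sum of squares. Since \<open>d\<close> does not change in direction \<open>u\<close>, the factor \<open>d\<^sup>k\<close> only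
  multiplies the entry by \<open>d\<^sup>2\<^sup>k\<close>, which disappears on the slice \<open>d = 1\<close>. There the entry is a
  polynomial \<open>W(a, b, c)\<close>, and every polynomial \<open>F\<close> occurring in a representation
  \<open>W = \<Sum> F\<^sup>2\<close> satisfies \<open>F\<^sup>2 \<le> W\<close>. The growth of \<open>W\<close> along lines bounds the degrees of \<open>F\<close>, and the zeros of \<open>W\<close>
  are zeros of \<open>F\<close>. These conditions leave so little freedom that
  \<open>8 F(-1/2, -1, 1/2) = F(-1, -2, 2) - 4 F(0, 0, -1/2)\<close> for every such \<open>F\<close>. However, \<open>W\<close> takes the values
  \<open>15/4\<close>, \<open>120\<close> and \<open>1/2\<close> at these three points, and the triangle inequality for vectors
  \<open>(F\<^sub>1, \<dots>, F\<^sub>K)\<close> would give \<open>8 \<surd>(15/4) \<le> \<surd>120 + 4 \<surd>(1/2)\<close>, which is false.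
\<close>

section \<open>The ring of multivariate polynomials\<close>

text \<open>The \<open>i\<close>-th variable, as a polynomial.\<close>

definition mvar :: "nat \<Rightarrow> real_mpoly" where
  "mvar i = Poly_Mapping.single (Poly_Mapping.single i 1) 1"

lemma subst_mpoly_monomial_add:
  fixes v :: "nat \<Rightarrow> 'r::comm_semiring_1"
  shows "(\<Prod>i\<in>Poly_Mapping.keys (m + m'). v i ^ Poly_Mapping.lookup (m + m') i) =
    (\<Prod>i\<in>Poly_Mapping.keys m. v i ^ Poly_Mapping.lookup m i) *
    (\<Prod>i\<in>Poly_Mapping.keys m'. v i ^ Poly_Mapping.lookup m' i)"
proof -
  let ?K = "Poly_Mapping.keys m \<union> Poly_Mapping.keys m'"
  have ext: "(\<Prod>i\<in>Poly_Mapping.keys k. v i ^ Poly_Mapping.lookup k i) = (\<Prod>i\<in>?K. v i ^ Poly_Mapping.lookup k i)"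
    if "Poly_Mapping.keys k \<subseteq> ?K" for k
    using that by (intro prod.mono_neutral_left) (auto simp: in_keys_iff)
  have "Poly_Mapping.keys (m + m') \<subseteq> ?K"
    using Poly_Mapping.keys_add[of m m'] by auto
  then have "(\<Prod>i\<in>Poly_Mapping.keys (m + m'). v i ^ Poly_Mapping.lookup (m + m') i) =
      (\<Prod>i\<in>?K. v i ^ Poly_Mapping.lookup (m + m') i)"
    by (rule ext)
  also have "\<dots> = (\<Prod>i\<in>?K. v i ^ Poly_Mapping.lookup m i) * (\<Prod>i\<in>?K. v i ^ Poly_Mapping.lookup m' i)"
    by (simp add: lookup_add power_add prod.distrib)
  also have "\<dots> = (\<Prod>i\<in>Poly_Mapping.keys m. v i ^ Poly_Mapping.lookup m i) *
      (\<Prod>i\<in>Poly_Mapping.keys m'. v i ^ Poly_Mapping.lookup m' i)"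
    by (simp add: ext[of m] ext[of m'])
  finally show ?thesis .
qed

lemma real_mpoly_sum_monomials:
  fixes p :: real_mpoly
  shows "p = (\<Sum>m\<in>Poly_Mapping.keys p. Poly_Mapping.single m (Poly_Mapping.lookup p m))"
  by (rule poly_mapping_eqI) (auto simp: lookup_sum lookup_single when_def in_keys_iff sum.delta')

lemma subst_mpoly_mult:
  fixes h :: "real \<Rightarrow> 'r::comm_semiring_1"
  assumes add: "\<And>a b. h (a + b) = h a + h b" and zero: "h 0 = 0" and mult: "\<And>a b. h (a * b) = h a * h b"
  shows "subst_mpoly h v (p * q) = subst_mpoly h v p * subst_mpoly h v q"
proof -
  have "p * q = (\<Sum>m\<in>Poly_Mapping.keys p. \<Sum>m'\<in>Poly_Mapping.keys q.
      Poly_Mapping.single (m + m') (Poly_Mapping.lookup p m * Poly_Mapping.lookup q m'))"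
    by (subst real_mpoly_sum_monomials[of p], subst real_mpoly_sum_monomials[of q])
       (simp add: sum_product Poly_Mapping.mult_single)
  then have "subst_mpoly h v (p * q) = (\<Sum>m\<in>Poly_Mapping.keys p. \<Sum>m'\<in>Poly_Mapping.keys q.
      h (Poly_Mapping.lookup p m * Poly_Mapping.lookup q m') *
      (\<Prod>i\<in>Poly_Mapping.keys (m + m'). v i ^ Poly_Mapping.lookup (m + m') i))"
    by (simp add: subst_mpoly_sum[of h, OF add zero] subst_mpoly_single[of h, OF zero])
  also have "\<dots> = subst_mpoly h v p * subst_mpoly h v q"
    by (simp add: subst_mpoly_def sum_product mult subst_mpoly_monomial_add ac_simps)
  finally show ?thesis .
qed

lemma subst_mpoly_one:
  assumes "h 0 = 0" "h 1 = 1"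
  shows "subst_mpoly h v 1 = 1"
  using subst_mpoly_single[of h v 0 1] assms by (simp add: single_one)

lemma subst_mpoly_power:
  fixes h :: "real \<Rightarrow> 'r::comm_semiring_1"
  assumes "\<And>a b. h (a + b) = h a + h b" "h 0 = 0" "\<And>a b. h (a * b) = h a * h b" "h 1 = 1"
  shows "subst_mpoly h v (p ^ k) = subst_mpoly h v p ^ k"
  by (induction k) (simp_all add: subst_mpoly_one[of h] subst_mpoly_mult[of h] assms)

lemma subst_mpoly_mvar:
  assumes "h 0 = 0" "h 1 = 1"
  shows "subst_mpoly h v (mvar i) = v i"
  by (simp add: mvar_def subst_mpoly_single assms)

lemma eval_mpoly_simps:
  "eval_mpoly (p + q) x = eval_mpoly p x + eval_mpoly q x"
  "eval_mpoly (p * q) x = eval_mpoly p x * eval_mpoly q x"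
  "eval_mpoly (p ^ k) x = eval_mpoly p x ^ k"
  "eval_mpoly (mvar i) x = x $ i"
  "eval_mpoly (Poly_Mapping.single 0 c) x = c"
  by (simp_all add: eval_mpoly_def subst_mpoly_add subst_mpoly_mult subst_mpoly_power
      subst_mpoly_mvar subst_mpoly_single)

lemma line_poly_simps:
  "line_poly (p + q) e x = line_poly p e x + line_poly q e x"
  "line_poly (p * q) e x = line_poly p e x * line_poly q e x"
  "line_poly (p ^ k) e x = line_poly p e x ^ k"
  "line_poly (mvar i) e x = [:x $ i, e $ i:]"
  "line_poly (Poly_Mapping.single 0 c) e x = [:c:]"
  by (simp_all add: line_poly_def subst_mpoly_add subst_mpoly_mult subst_mpoly_power
      subst_mpoly_mvar subst_mpoly_single one_pCons)

lemma mpolys_add: "p \<in> mpolys n \<Longrightarrow> q \<in> mpolys n \<Longrightarrow> p + q \<in> mpolys n"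
  using Poly_Mapping.keys_add[of p q] by (auto simp: mpolys_def subset_iff)

lemma mpolys_mult:
  assumes "p \<in> mpolys n" "q \<in> mpolys n"
  shows "p * q \<in> mpolys n"
  unfolding mpolys_def
proof (intro CollectI ballI)
  fix m assume "m \<in> Poly_Mapping.keys (p * q)"
  then obtain k l where "k \<in> Poly_Mapping.keys p" "l \<in> Poly_Mapping.keys q" "m = k + l"
    using keys_mult[of p q] by auto
  then show "Poly_Mapping.keys m \<subseteq> {..<n}"
    using assms Poly_Mapping.keys_add[of k l] unfolding mpolys_def by blast
qed

lemma mpolys_sum: "(\<And>i. i \<in> I \<Longrightarrow> f i \<in> mpolys n) \<Longrightarrow> sum f I \<in> mpolys n"
proof (induction I rule: infinite_finite_induct)
  case (insert i I)
  then show ?case by (simp add: mpolys_add)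
qed (simp_all add: mpolys_def)

lemma mpolys_const: "Poly_Mapping.single 0 c \<in> mpolys n"
  by (auto simp: mpolys_def)

lemma mpolys_partial_mpoly:
  assumes "p \<in> mpolys n"
  shows "partial_mpoly i p \<in> mpolys n"
  unfolding partial_mpoly_def
proof (intro mpolys_sum)
  fix m assume "m \<in> Poly_Mapping.keys p"
  moreover have "Poly_Mapping.keys (m - Poly_Mapping.single i 1) \<subseteq> Poly_Mapping.keys m"
    by (auto simp: in_keys_iff lookup_minus)
  ultimately show "Poly_Mapping.single (m - Poly_Mapping.single i 1)
      (Poly_Mapping.lookup p m * real (Poly_Mapping.lookup m i)) \<in> mpolys n"
    using assms by (fastforce simp: mpolys_def)
qed

lemma mpolys_dir_deriv: "p \<in> mpolys n \<Longrightarrow> dir_deriv n u p \<in> mpolys n"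
  unfolding dir_deriv_def by (intro mpolys_sum mpolys_mult mpolys_const mpolys_partial_mpoly)

lemma homogeneous_mpolys_add:
  "p \<in> homogeneous_mpolys n d \<Longrightarrow> q \<in> homogeneous_mpolys n d \<Longrightarrow> p + q \<in> homogeneous_mpolys n d"
  using Poly_Mapping.keys_add[of p q] by (auto simp: homogeneous_mpolys_def intro: mpolys_add)

lemma homogeneous_mpolys_mult:
  assumes "p \<in> homogeneous_mpolys n d" "q \<in> homogeneous_mpolys n d'"
  shows "p * q \<in> homogeneous_mpolys n (d + d')"
proof -
  have deg: "(\<Sum>i\<in>Poly_Mapping.keys (k + l). Poly_Mapping.lookup (k + l) i) =
      (\<Sum>i\<in>Poly_Mapping.keys k. Poly_Mapping.lookup k i) + (\<Sum>i\<in>Poly_Mapping.keys l. Poly_Mapping.lookup l i)"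
    for k l :: "nat \<Rightarrow>\<^sub>0 nat"
    by (rule setsum_keys_plus_distrib) simp_all
  show ?thesis
    using assms keys_mult[of p q]
    by (fastforce simp: homogeneous_mpolys_def deg intro: mpolys_mult)
qed

lemma homogeneous_mpolys_const: "Poly_Mapping.single 0 c \<in> homogeneous_mpolys n 0"
  by (auto simp: homogeneous_mpolys_def mpolys_const)

lemma homogeneous_mpolys_power:
  "p \<in> homogeneous_mpolys n d \<Longrightarrow> p ^ k \<in> homogeneous_mpolys n (k * d)"
proof (induction k)
  case 0
  show ?case using homogeneous_mpolys_const[of 1 n] by (simp add: single_one)
next
  case (Suc k)
  then show ?case using homogeneous_mpolys_mult by fastforce
qed

lemma homogeneous_mpolys_mvar: "i < n \<Longrightarrow> mvar i \<in> homogeneous_mpolys n 1"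
  by (auto simp: homogeneous_mpolys_def mpolys_def mvar_def)

section \<open>Real-rooted polynomials\<close>

text \<open>All complex zeros are real. The zero polynomial is not real-rooted in this sense.\<close>

definition real_rooted :: "real poly \<Rightarrow> bool" where
  "real_rooted f \<longleftrightarrow> (\<forall>z. poly (map_poly complex_of_real f) z = 0 \<longrightarrow> z \<in> \<real>)"

lemma map_poly_of_real_mult:
  "map_poly complex_of_real (f * g) = map_poly complex_of_real f * map_poly complex_of_real g"
  by (rule poly_eqI) (simp add: coeff_map_poly coeff_mult)

lemma real_rooted_mult: "real_rooted f \<Longrightarrow> real_rooted g \<Longrightarrow> real_rooted (f * g)"
  by (auto simp: real_rooted_def map_poly_of_real_mult)

lemma real_rooted_power: "real_rooted f \<Longrightarrow> real_rooted (f ^ k)"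
proof (induction k)
  case 0
  show ?case by (simp add: real_rooted_def map_poly_1')
next
  case (Suc k)
  then show ?case by (simp add: real_rooted_mult)
qed

lemma real_rooted_linear:
  assumes "a \<noteq> 0"
  shows "real_rooted [:b, a:]"
  unfolding real_rooted_def
proof (intro allI impI)
  fix z assume "poly (map_poly complex_of_real [:b, a:]) z = 0"
  then have "complex_of_real a * z = - complex_of_real b"
    using assms by (simp add: map_poly_pCons add_eq_0_iff mult.commute)
  then have "z = complex_of_real (- b / a)"
    using assms by (simp add: field_simps)
  then show "z \<in> \<real>" by (metis Reals_of_real)
qed

lemma poly_root_above:
  fixes f :: "real poly"
  assumes "lead_coeff f > 0" "degree f > 0" "poly f r \<le> 0"
  shows "\<exists>x\<ge>r. poly f x = 0"
proof -
  obtain N where N: "\<And>x. x \<ge> N \<Longrightarrow> lead_coeff f \<le> poly f x"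
    using poly_pinfty_gt_lc[OF assms(1)] by blast
  have "poly f (max N (r + 1)) > 0"
    using N[of "max N (r + 1)"] assms(1) by simp
  then obtain x where "x \<ge> r" "poly f x = 0"
    using IVT'[of "poly f" r 0 "max N (r + 1)"] assms(3) by (force intro!: continuous_intros)
  then show ?thesis by blast
qed

lemma linear_factor:
  fixes f :: "real poly"
  assumes "poly f r = 0" "degree f = Suc k" "lead_coeff f > 0"
  obtains g where "f = [:-r, 1:] * g" "degree g = k" "lead_coeff g > 0"
proof -
  obtain g where g: "f = [:-r, 1:] * g"
    using assms(1) by (auto simp: poly_eq_0_iff_dvd dvd_def)
  with assms have "g \<noteq> 0" by auto
  with g assms(2) have "degree g = k"
    by (metis One_nat_def add_left_cancel degree_mult_eq degree_pCons_eq_if degree_1 one_pCons one_neq_zero pCons_eq_0_iff plus_1_eq_Suc)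
  moreover have "lead_coeff f = lead_coeff g"
    using g by (simp only: lead_coeff_mult) simp
  ultimately show ?thesis using that g assms(3) by simp
qed

text \<open>
  The sign pattern \<open>\<le> 0\<close>, \<open>\<ge> 0\<close>, \<open>\<le> 0\<close> at three increasing points forces four real zeros. The
  inequalities are weak, so the zeros may coincide; splitting off one linear factor at a time
  accounts for multiplicities.
\<close>

lemma real_rooted_quartic:
  fixes f :: "real poly"
  assumes "degree f = 4" "lead_coeff f > 0"
    and lmr: "l < m" "m < r" and "poly f l \<le> 0" "poly f m \<ge> 0" "poly f r \<le> 0"
  shows "real_rooted f"
proof -
  obtain r1 where r1: "r1 \<ge> r" "poly f r1 = 0"
    using poly_root_above[of f r] assms by auto
  obtain g where g: "f = [:-r1, 1:] * g" "degree g = 3" "lead_coeff g > 0"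
    using linear_factor[of f r1 3] r1 assms by auto
  \<comment> \<open>Dividing by \<open>X - r1\<close> reverses the signs at \<open>l\<close> and \<open>m\<close>, as both lie below \<open>r1\<close>.\<close>
  have "poly g l \<ge> 0" "poly g m \<le> 0"
    using assms(3-6) r1(1) unfolding g(1) poly_mult
    by (auto simp: mult_le_0_iff zero_le_mult_iff)
  then obtain r2 where r2: "l \<le> r2" "r2 \<le> m" "poly g r2 = 0"
    using IVT2'[of "poly g" m 0 l] lmr by (force intro!: continuous_intros)
  obtain h where h: "g = [:-r2, 1:] * h" "degree h = 2" "lead_coeff h > 0"
    using linear_factor[of g r2 2] r2 g by auto
  have "\<exists>p. poly h p \<le> 0"
  proof (cases "r2 = m")
    case True
    then have "poly h l \<le> 0"
      using \<open>poly g l \<ge> 0\<close> lmr r2 True unfolding h(1) poly_mult by (auto simp: zero_le_mult_iff)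
    then show ?thesis by blast
  next
    case False
    then have "poly h m \<le> 0"
      using \<open>poly g m \<le> 0\<close> r2 False unfolding h(1) poly_mult by (auto simp: mult_le_0_iff)
    then show ?thesis by blast
  qed
  then obtain r3 where r3: "poly h r3 = 0"
    using poly_root_above[of h] h by auto
  obtain k where k: "h = [:-r3, 1:] * k" "degree k = 1" "lead_coeff k > 0"
    using linear_factor[of h r3 1] r3 h by auto
  have "k = [:coeff k 0, coeff k 1:]"
    using k(2) by (intro poly_eqI) (auto simp: coeff_pCons coeff_eq_0 split: nat.split)
  then have "real_rooted k"
    using k(2,3) by (metis real_rooted_linear less_irrefl)
  then show ?thesis
    unfolding g(1) h(1) k(1) by (intro real_rooted_mult) (auto intro: real_rooted_linear)
qed

section \<open>The specialized Vamos polynomial\<close>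

text \<open>
  The polynomial \<open>c\<^sup>2 d\<^sup>2 + 4 e\<^sub>1 e\<^sub>3\<close>, over any commutative ring: it is used for real numbers, for
  univariate polynomials (restrictions to lines) and for the variables themselves.
\<close>

definition vamos :: "'a::comm_ring_1 \<Rightarrow> 'a \<Rightarrow> 'a \<Rightarrow> 'a \<Rightarrow> 'a" where
  "vamos a b c d = c\<^sup>2 * d\<^sup>2 + 4 * ((a + b + c + d) * (a * b * c + a * b * d + a * c * d + b * c * d))"

text \<open>The partial derivative of \<^const>\<open>vamos\<close> with respect to the third variable \<open>c\<close>.\<close>

definition vamos_deriv :: "'a::comm_ring_1 \<Rightarrow> 'a \<Rightarrow> 'a \<Rightarrow> 'a \<Rightarrow> 'a" where
  "vamos_deriv a b c d = 2 * c * d\<^sup>2 +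
     4 * ((a * b * c + a * b * d + a * c * d + b * c * d) + (a + b + c + d) * (a * b + a * d + b * d))"

lemma poly_vamos: "poly (vamos f g h k) t = vamos (poly f t) (poly g t) (poly h t) (poly k t)"
  by (simp add: vamos_def)

lemma poly_vamos_deriv:
  "poly (vamos_deriv f g h k) t = vamos_deriv (poly f t) (poly g t) (poly h t) (poly k t)"
  by (simp add: vamos_deriv_def)

text \<open>Coefficients along lines in the direction that increases \<open>c\<close> and \<open>d\<close>.\<close>

lemma vamos_line_coeffs:
  fixes a b c d :: real
  shows "vamos [:a:] [:b:] [:c, 1:] [:d, 1:] =
    [: vamos a b c d,
       8*a^2*b + 4*a^2*c + 4*a^2*d + 8*a*b^2 + 24*a*b*c + 24*a*b*d + 4*a*c^2 + 16*a*c*d + 4*a*d^2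
         + 4*b^2*c + 4*b^2*d + 4*b*c^2 + 16*b*c*d + 4*b*d^2 + 2*c^2*d + 2*c*d^2,
       4*a^2 + 24*a*b + 12*a*c + 12*a*d + 4*b^2 + 12*b*c + 12*b*d + c^2 + 4*c*d + d^2,
       8*a + 8*b + 2*c + 2*d, 1:]" (is "?l = ?r")
proof -
  have "poly ?l t = poly ?r t" for t
    unfolding poly_vamos by (simp add: vamos_def power2_eq_square algebra_simps)
  then show ?thesis by (simp add: poly_eq_poly_eq_iff[symmetric] fun_eq_iff)
qed

lemma vamos_deriv_line_coeffs:
  fixes a b c d :: real
  shows "vamos_deriv [:a:] [:b:] [:c, 1:] [:d, 1:] =
    [: vamos_deriv a b c d,
       4*a^2 + 24*a*b + 8*a*c + 16*a*d + 4*b^2 + 8*b*c + 16*b*d + 4*c*d + 2*d^2,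
       12*a + 12*b + 2*c + 4*d, 2:]" (is "?l = ?r")
proof -
  have "poly ?l t = poly ?r t" for t
    by (simp add: vamos_deriv_def power2_eq_square algebra_simps)
  then show ?thesis by (simp add: poly_eq_poly_eq_iff[symmetric] fun_eq_iff)
qed

lemma real_rooted_vamos_line:
  fixes a b c d :: real
  shows "real_rooted (vamos [:a:] [:b:] [:c, 1:] [:d, 1:])" (is "real_rooted ?f")
proof -
  define s q D w where "s = a + b" and "q = (a - b)\<^sup>2" and "D = ((c - d) / 2)\<^sup>2"
    and "w = sqrt (2 * s\<^sup>2 + D)"
  have q0: "q \<ge> 0" and D0: "D \<ge> 0" by (simp_all add: q_def D_def)
  have w: "w \<ge> 0" "w\<^sup>2 = 2 * s\<^sup>2 + D" using D0 by (simp_all add: w_def)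
  have deg: "degree ?f = 4" "lead_coeff ?f > 0" by (simp_all add: vamos_line_coeffs)
  have val: "poly ?f (\<tau> - (c + d) / 2) =
      (\<tau>\<^sup>2 - D + 2 * s * (s + 2 * \<tau>))\<^sup>2 - 2 * ((s + 2 * \<tau>) * (2 * s^3 + (3 * s\<^sup>2 + q) * \<tau>))" for \<tau>
  proof -
    define \<delta> where "\<delta> = (c - d) / 2"
    have eqs: "c + (\<tau> - (c + d) / 2) = \<tau> + \<delta>" "d + (\<tau> - (c + d) / 2) = \<tau> - \<delta>"
      by (simp_all add: \<delta>_def field_simps)
    have "poly ?f (\<tau> - (c + d) / 2) = vamos a b (\<tau> + \<delta>) (\<tau> - \<delta>)"
      unfolding poly_vamos eqs[symmetric] by simp
    also have "\<dots> = (\<tau>\<^sup>2 - \<delta>\<^sup>2 + 2 * s * (s + 2 * \<tau>))\<^sup>2 - 2 * ((s + 2 * \<tau>) * (2 * s^3 + (3 * s\<^sup>2 + q) * \<tau>))"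
      unfolding s_def q_def vamos_def by (simp add: power2_eq_square power3_eq_cube algebra_simps)
    finally show ?thesis by (simp add: D_def \<delta>_def)
  qed
  have quartic: "real_rooted ?f"
    if "l < m" "m < r" "poly ?f (l - (c + d) / 2) \<le> 0" "poly ?f (m - (c + d) / 2) \<ge> 0"
      "poly ?f (r - (c + d) / 2) \<le> 0" for l m r
    using real_rooted_quartic[OF deg _ _ that(3-5)] that(1,2) by simp
  have mid: "poly ?f (- s / 2 - (c + d) / 2) \<ge> 0"
    unfolding val by simp
  have zero: "poly ?f (0 - (c + d) / 2) \<le> 0" if "D \<le> 4 * s\<^sup>2"
  proof -
    have "poly ?f (0 - (c + d) / 2) = D * (D - 4 * s\<^sup>2)"
      unfolding val by (simp add: power2_eq_square power3_eq_cube algebra_simps)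
    then show ?thesis using that D0 by (simp add: mult_nonneg_nonpos)
  qed
  \<comment> \<open>The points \<open>- 2 * s \<plusminus> w\<close> are the zeros of the squared expression in \<open>val\<close>.\<close>
  have root: "poly ?f (\<tau> - (c + d) / 2) \<le> 0"
    if "(\<tau> + 2 * s)\<^sup>2 = w\<^sup>2" "0 \<le> (s + 2 * \<tau>) * (2 * s^3 + (3 * s\<^sup>2 + q) * \<tau>)" for \<tau>
  proof -
    have "\<tau>\<^sup>2 - D + 2 * s * (s + 2 * \<tau>) = 0"
      using that(1) w(2) by (simp add: power2_eq_square algebra_simps)
    then show ?thesis using that(2) unfolding val by simp
  qed
  consider "s > 0" | "s < 0" | "s = 0" "D + q > 0" | "s = 0" "D = 0" "q = 0"
    using q0 D0 by linarith
  then show ?thesis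
  proof cases
    case 1
    have left: "poly ?f ((- 2 * s - w) - (c + d) / 2) \<le> 0"
    proof -
      have "(3 * s\<^sup>2 + q) * (2 * s + w) \<ge> (3 * s\<^sup>2) * (2 * s)"
        using 1 q0 w by (intro mult_mono) auto
      moreover have "s^3 > 0" using 1 by simp
      ultimately have "2 * s^3 + (3 * s\<^sup>2 + q) * (- 2 * s - w) \<le> 0"
        by (simp add: algebra_simps power3_eq_cube power2_eq_square)
      then show ?thesis
        using 1 w by (intro root mult_nonpos_nonpos) (simp_all add: power2_eq_square algebra_simps)
    qed
    show ?thesis
    proof (cases "D \<le> 4 * s\<^sup>2")
      case True
      show ?thesis by (rule quartic[OF _ _ left mid zero]) (use 1 w True in auto)
    next
      case False
      then have "4 * s\<^sup>2 < 2 * s\<^sup>2 + D" using zero_le_power2[of s] by linarith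
      have "(2 * s)\<^sup>2 < w\<^sup>2"
        using \<open>4 * s\<^sup>2 < 2 * s\<^sup>2 + D\<close> by (simp add: w(2) power_mult_distrib)
      then have "w > 2 * s" using w(1) by (rule power2_less_imp_less)
      then have right: "poly ?f ((w - 2 * s) - (c + d) / 2) \<le> 0"
        using 1 q0 by (intro root mult_nonneg_nonneg add_nonneg_nonneg) auto
      show ?thesis by (rule quartic[OF _ _ left mid right]) (use 1 w \<open>w > 2 * s\<close> in auto)
    qed
  next
    case 2
    have right: "poly ?f ((w - 2 * s) - (c + d) / 2) \<le> 0"
    proof -
      have "(3 * s\<^sup>2 + q) * (w - 2 * s) \<ge> (3 * s\<^sup>2) * (- 2 * s)"
        using 2 q0 w by (intro mult_mono) auto
      moreover have "s^3 < 0" using 2 by simp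
      ultimately have "2 * s^3 + (3 * s\<^sup>2 + q) * (w - 2 * s) \<ge> 0"
        by (simp add: algebra_simps power3_eq_cube power2_eq_square)
      then show ?thesis
        using 2 w by (intro root mult_nonneg_nonneg) auto
    qed
    show ?thesis
    proof (cases "D \<le> 4 * s\<^sup>2")
      case True
      show ?thesis by (rule quartic[OF _ _ zero mid right]) (use 2 w True in auto)
    next
      case False
      then have "4 * s\<^sup>2 < 2 * s\<^sup>2 + D" using zero_le_power2[of s] by linarith
      have "(- 2 * s)\<^sup>2 < w\<^sup>2"
        using \<open>4 * s\<^sup>2 < 2 * s\<^sup>2 + D\<close> by (simp add: w(2) power_mult_distrib)
      then have "w > - 2 * s" using w(1) by (rule power2_less_imp_less)
      have left: "poly ?f ((- 2 * s - w) - (c + d) / 2) \<le> 0"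
      proof -
        have "s^3 < 0" using 2 by simp
        moreover have "(3 * s\<^sup>2 + q) * (- 2 * s - w) \<le> 0"
          using \<open>w > - 2 * s\<close> q0 by (intro mult_nonneg_nonpos) auto
        ultimately have "2 * s^3 + (3 * s\<^sup>2 + q) * (- 2 * s - w) \<le> 0" by linarith
        moreover have "s + 2 * (- 2 * s - w) \<le> 0" using \<open>w > - 2 * s\<close> 2 by simp
        ultimately show ?thesis
          by (intro root mult_nonpos_nonpos) (simp_all add: power2_eq_square)
      qed
      show ?thesis by (rule quartic[OF _ _ left mid right]) (use 2 w \<open>w > - 2 * s\<close> in auto)
    qed
  next
    case 3
    \<comment> \<open>For \<open>s = 0\<close> the quartic is \<open>(\<tau>\<^sup>2 - D)\<^sup>2 - 4 * q * \<tau>\<^sup>2\<close>, which equals \<open>- 3 * q\<^sup>2 - 4 * q * D\<close> at \<open>\<tau>\<^sup>2 = D + q\<close>.\<close>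
    define r where "r = sqrt (D + q)"
    have r: "r > 0" "r\<^sup>2 = D + q" using 3 by (simp_all add: r_def)
    have end_le: "poly ?f (\<tau> - (c + d) / 2) \<le> 0" if "\<tau>\<^sup>2 = D + q" for \<tau>
    proof -
      have "poly ?f (\<tau> - (c + d) / 2) = (\<tau>\<^sup>2 - D)\<^sup>2 - 4 * q * \<tau>\<^sup>2"
        unfolding val \<open>s = 0\<close> by (simp add: power2_eq_square)
      also have "\<dots> = - (3 * q\<^sup>2 + 4 * (q * D))"
        unfolding that by (simp add: power2_eq_square algebra_simps)
      also have "\<dots> \<le> 0" unfolding neg_le_0_iff_le using q0 D0 by simp
      finally show ?thesis .
    qed
    show ?thesis
      by (rule quartic[OF _ _ end_le mid end_le, of "- r" r]) (use r 3 in auto)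
  next
    case 4
    then have "a = - b" "c = d" "a = b" by (auto simp: s_def q_def D_def)
    then have "vamos [:a:] [:b:] [:c, 1:] [:d, 1:] = [:c, 1:] ^ 4"
      by (simp add: vamos_def power2_eq_square numeral_eq_Suc)
    then show ?thesis by (simp only:) (intro real_rooted_power real_rooted_linear; simp)
  qed
qed

section \<open>A nonnegative polynomial that is not a sum of squares\<close>

lemma degree_le_of_square_le:
  fixes f g :: "real poly"
  assumes le: "\<And>t. (poly f t)\<^sup>2 \<le> poly g t" and deg: "degree g \<le> 2 * m"
  shows "degree f \<le> m"
proof (rule ccontr)
  assume "\<not> degree f \<le> m"
  then have "degree g < degree (f * f)" by (subst degree_mult_eq) (use deg in auto)
  then have lc: "lead_coeff (f * f - g) = lead_coeff (f * f)"
    by (metis (no_types) coeff_diff coeff_eq_0 degree_add_eq_left degree_minus diff_conv_add_uminus diff_zero)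
  moreover have "lead_coeff f \<noteq> 0" using \<open>\<not> degree f \<le> m\<close> by auto
  then have "lead_coeff (f * f) > 0"
    unfolding lead_coeff_mult by (metis not_real_square_gt_zero)
  ultimately have "lead_coeff (f * f - g) > 0" by simp
  then obtain x where "poly (f * f - g) x > 0"
    using poly_pinfty_gt_lc[of "f * f - g"] by (metis order.refl order.strict_trans2)
  then show False using le[of x] by (simp add: power2_eq_square)
qed

lemma affine_interpolation:
  fixes G :: "real \<Rightarrow> real"
  assumes "\<exists>f. \<forall>t. poly f t = G t" and "\<And>t. (G t)\<^sup>2 \<le> poly g t" "degree g \<le> 2"
  shows "G t = G 0 + t * (G 1 - G 0)"
proof -
  obtain f where f: "\<And>t. G t = poly f t" using assms(1) by metis
  have "degree f \<le> 1"
    using degree_le_of_square_le[of f g 1] assms f by simp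
  then have "f = [:coeff f 0, coeff f 1:]"
    by (intro poly_eqI) (auto simp: coeff_pCons coeff_eq_0 split: nat.split)
  then have "G t = coeff f 0 + t * coeff f 1" for t
    unfolding f by (metis mult.commute mult_zero_right poly_0 poly_pCons add.right_neutral)
  then show ?thesis by simp
qed

lemma quadratic_interpolation:
  fixes G :: "real \<Rightarrow> real"
  assumes "\<exists>f. \<forall>t. poly f t = G t" and "\<And>t. (G t)\<^sup>2 \<le> poly g t" "degree g \<le> 4"
  shows "G t = G 0 + t * ((G 1 - G (- 1)) / 2) + t\<^sup>2 * ((G 1 + G (- 1)) / 2 - G 0)"
proof -
  obtain f where f: "\<And>t. G t = poly f t" using assms(1) by metis
  have "degree f \<le> 2"
    using degree_le_of_square_le[of f g 2] assms f by simp
  then have "f = [:coeff f 0, coeff f 1, coeff f 2:]"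
    by (intro poly_eqI) (auto simp: coeff_pCons coeff_eq_0 numeral_2_eq_2 split: nat.split)
  then have "G t = poly [:coeff f 0, coeff f 1, coeff f 2:] t" for t
    unfolding f by metis
  then show ?thesis by (simp add: algebra_simps power2_eq_square)
qed

text \<open>
  The polynomial \<open>D\<^sub>e v D\<^sub>u v - v D\<^sub>e D\<^sub>u v\<close> for the specialized Vamos polynomial \<open>v\<close>, the direction \<open>e\<close> that
  increases \<open>c\<close> and \<open>d\<close>, and the direction \<open>u\<close> that increases \<open>c\<close>, restricted to \<open>d = 1\<close>. Its degree in \<open>c\<close> is
  2; the first three definitions are the coefficients of the powers of \<open>c\<close>.
\<close>

definition vamos_wronskian0 :: "real \<Rightarrow> real \<Rightarrow> real" where
  "vamos_wronskian0 a b =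
      32*a^4*b^2 + 64*a^3*b^3 + 32*a^2*b^4 + 32*a^4*b + 160*a^3*b^2 + 160*a^2*b^3
      + 32*a*b^4 + 16*a^4 + 128*a^3*b + 288*a^2*b^2 + 128*a*b^3 + 16*b^4 + 32*a^3
      + 120*a^2*b + 120*a*b^2 + 32*b^3 + 16*a^2 + 24*a*b + 16*b^2"

definition vamos_wronskian1 :: "real \<Rightarrow> real \<Rightarrow> real" where
  "vamos_wronskian1 a b =
      64*a^3*b^2 + 64*a^2*b^3 + 64*a^3*b + 256*a^2*b^2 + 64*a*b^3 + 32*a^3 + 224*a^2*b
      + 224*a*b^2 + 32*b^3 + 40*a^2 + 96*a*b + 40*b^2 + 8*a + 8*b"

definition vamos_wronskian2 :: "real \<Rightarrow> real \<Rightarrow> real" where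
  "vamos_wronskian2 a b =
      64*a^2*b^2 + 88*a^2*b + 88*a*b^2 + 44*a^2 + 96*a*b + 44*b^2 + 16*a + 16*b + 2"

definition vamos_wronskian :: "real \<Rightarrow> real \<Rightarrow> real \<Rightarrow> real" where
  "vamos_wronskian a b c = vamos_wronskian0 a b + c * vamos_wronskian1 a b + c\<^sup>2 * vamos_wronskian2 a b"

lemmas vamos_wronskian_defs =
  vamos_wronskian0_def vamos_wronskian1_def vamos_wronskian2_def vamos_wronskian_def

text \<open>
  Polynomial functions of three variables enter the argument only through their restrictions to
  lines, which are univariate polynomials.
\<close>

definition poly_on_lines :: "(real \<Rightarrow> real \<Rightarrow> real \<Rightarrow> real) \<Rightarrow> bool" where
  "poly_on_lines F \<longleftrightarrow>
     (\<forall>a b c a' b' c'. \<exists>f. \<forall>t. poly f t = F (a + t * a') (b + t * b') (c + t * c'))"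

lemma poly_on_linesD:
  assumes "poly_on_lines F"
  shows "\<exists>f. \<forall>t. poly f t = F (a + t * a') (b + t * b') (c + t * c')"
  using assms by (simp add: poly_on_lines_def)

text \<open>
  Each summand has the form \<open>F = F\<^sub>0(a, b) + c F\<^sub>1(a, b)\<close> with \<open>F\<^sub>1\<close> of degree at most 1 and \<open>F\<^sub>0\<close> of degree at
  most 2 in each variable. The zeros of \<^const>\<open>vamos_wronskian\<close> at \<open>(0, 0, 0)\<close>, \<open>(-1, 0, 0)\<close>, \<open>(0, -1, 0)\<close>
  and its merely quadratic growth along the line \<open>(t, -t, -1)\<close> impose linear relations on the
  coefficients of \<open>F\<close>. From them follows a linear relation between the values of \<open>F\<close> at three points that
  is incompatible with the values of \<^const>\<open>vamos_wronskian\<close>.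
\<close>

lemma vamos_wronskian_not_sos:
  fixes F :: "'k \<Rightarrow> real \<Rightarrow> real \<Rightarrow> real \<Rightarrow> real"
  assumes K: "finite K" and poly: "\<And>k. k \<in> K \<Longrightarrow> poly_on_lines (F k)"
    and sos: "\<And>a b c. (\<Sum>k\<in>K. (F k a b c)\<^sup>2) = vamos_wronskian a b c"
  shows False
proof -
  have le: "(F k a b c)\<^sup>2 \<le> vamos_wronskian a b c" if "k \<in> K" for k a b c
    unfolding sos[symmetric] using K that by (intro member_le_sum) auto
  have affine_c: "F k a b c = F k a b 0 + c * (F k a b 1 - F k a b 0)" if k: "k \<in> K" for k a b c
  proof (rule affine_interpolation)
    show "\<exists>f. \<forall>t. poly f t = F k a b t"
      using poly_on_linesD[OF poly[OF k], of a 0 b 0 0 1] by simp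
    show "(F k a b t)\<^sup>2 \<le> poly [:vamos_wronskian0 a b, vamos_wronskian1 a b, vamos_wronskian2 a b:] t" for t
      using le[OF k, of a b t] by (simp add: vamos_wronskian_def algebra_simps power2_eq_square)
  qed simp
  define F1 where "F1 k a b = F k a b 1 - F k a b 0" for k a b
  \<comment> \<open>The second difference in \<open>c\<close> shows that the squares of the \<open>F1\<close> sum to the coefficient of \<open>c\<^sup>2\<close>.\<close>
  have F1_le: "(F1 k a b)\<^sup>2 \<le> vamos_wronskian2 a b" if k: "k \<in> K" for k a b
  proof -
    have "(F k a b 1)\<^sup>2 + (F k a b (- 1))\<^sup>2 - 2 * (F k a b 0)\<^sup>2 = 2 * (F1 k a b)\<^sup>2" if "k \<in> K" for k
    proof -
      have "F k a b (- 1) = F k a b 0 - F1 k a b" "F k a b 1 = F k a b 0 + F1 k a b"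
        using affine_c[OF that, of a b "- 1"] by (simp_all add: F1_def)
      then show ?thesis by (simp only:) (simp add: power2_eq_square algebra_simps)
    qed
    then have "2 * (\<Sum>k\<in>K. (F1 k a b)\<^sup>2) =
        (\<Sum>k\<in>K. (F k a b 1)\<^sup>2 + (F k a b (- 1))\<^sup>2 - 2 * (F k a b 0)\<^sup>2)"
      by (simp add: sum_distrib_left)
    also have "\<dots> = vamos_wronskian a b 1 + vamos_wronskian a b (- 1) - 2 * vamos_wronskian a b 0"
      by (simp add: sum.distrib sum_subtractf sum_distrib_left[symmetric] sos)
    finally have "(\<Sum>k\<in>K. (F1 k a b)\<^sup>2) = vamos_wronskian2 a b"
      by (simp add: vamos_wronskian_def)
    moreover have "(F1 k a b)\<^sup>2 \<le> (\<Sum>k\<in>K. (F1 k a b)\<^sup>2)"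
      using K k by (intro member_le_sum) auto
    ultimately show ?thesis by simp
  qed
  have rel: "8 * F k (-1/2) (-1) (1/2) = F k (-1) (-2) 2 - 4 * F k 0 0 (-1/2)" if k: "k \<in> K" for k
  proof -
    have F1a: "F1 k a b = F1 k 0 b + a * (F1 k 1 b - F1 k 0 b)" for a b
    proof (rule affine_interpolation)
      obtain f g where "\<And>t. poly f t = F k t b 1" "\<And>t. poly g t = F k t b 0"
        using poly_on_linesD[OF poly[OF k], of 0 1 b 0 _ 0] by simp metis
      then show "\<exists>f. \<forall>t. poly f t = F1 k t b"
        by (intro exI[of _ "f - g"]) (simp add: F1_def)
      show "(F1 k t b)\<^sup>2 \<le> poly [:44*b^2 + 16*b + 2, 88*b^2 + 96*b + 16, 64*b^2 + 88*b + 44:] t" for t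
        using F1_le[OF k, of t b] unfolding vamos_wronskian2_def by (simp add: algebra_simps power2_eq_square)
    qed simp
    have F1b: "F1 k a b = F1 k a 0 + b * (F1 k a 1 - F1 k a 0)" for a b
    proof (rule affine_interpolation)
      obtain f g where "\<And>t. poly f t = F k a t 1" "\<And>t. poly g t = F k a t 0"
        using poly_on_linesD[OF poly[OF k], of a 0 0 1 _ 0] by simp metis
      then show "\<exists>f. \<forall>t. poly f t = F1 k a t"
        by (intro exI[of _ "f - g"]) (simp add: F1_def)
      show "(F1 k a t)\<^sup>2 \<le> poly [:44*a^2 + 16*a + 2, 88*a^2 + 96*a + 16, 64*a^2 + 88*a + 44:] t" for t
        using F1_le[OF k, of a t] unfolding vamos_wronskian2_def by (simp add: algebra_simps power2_eq_square)
    qed simp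
    define n00 n01 n10 n11 where "n00 = F1 k 0 0" and "n01 = F1 k 0 1 - F1 k 0 0"
      and "n10 = F1 k 1 0 - F1 k 0 0" and "n11 = F1 k 1 1 - F1 k 1 0 - F1 k 0 1 + F1 k 0 0"
    have F1: "F1 k a b = n00 + n01 * b + n10 * a + n11 * (a * b)" for a b
      unfolding F1a[of a b] F1b[of 1 b] F1b[of 0 b] n00_def n01_def n10_def n11_def
      by (simp add: algebra_simps)
    have F0a: "F k a b 0 = F k 0 b 0 + a * ((F k 1 b 0 - F k (- 1) b 0) / 2)
        + a\<^sup>2 * ((F k 1 b 0 + F k (- 1) b 0) / 2 - F k 0 b 0)" for a b
    proof (rule quadratic_interpolation)
      show "\<exists>f. \<forall>t. poly f t = F k t b 0"
        using poly_on_linesD[OF poly[OF k], of 0 1 b 0 0 0] by simp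
      have "poly [:16*b^4 + 32*b^3 + 16*b^2, 32*b^4 + 128*b^3 + 120*b^2 + 24*b, 32*b^4 + 160*b^3 + 288*b^2 + 120*b + 16, 64*b^3 + 160*b^2 + 128*b + 32, 32*b^2 + 32*b + 16:] t = vamos_wronskian t b 0" for t
        by (simp add: vamos_wronskian_defs algebra_simps power2_eq_square power3_eq_cube power4_eq_xxxx)
      then show "(F k t b 0)\<^sup>2 \<le> poly [:16*b^4 + 32*b^3 + 16*b^2, 32*b^4 + 128*b^3 + 120*b^2 + 24*b, 32*b^4 + 160*b^3 + 288*b^2 + 120*b + 16, 64*b^3 + 160*b^2 + 128*b + 32, 32*b^2 + 32*b + 16:] t" for t
        using le[OF k, of t b 0] by simp
    qed simp
    have F0b: "F k a b 0 = F k a 0 0 + b * ((F k a 1 0 - F k a (- 1) 0) / 2)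
        + b\<^sup>2 * ((F k a 1 0 + F k a (- 1) 0) / 2 - F k a 0 0)" for a b
    proof (rule quadratic_interpolation)
      show "\<exists>f. \<forall>t. poly f t = F k a t 0"
        using poly_on_linesD[OF poly[OF k], of a 0 0 1 0 0] by simp
      have "poly [:16*a^4 + 32*a^3 + 16*a^2, 32*a^4 + 128*a^3 + 120*a^2 + 24*a, 32*a^4 + 160*a^3 + 288*a^2 + 120*a + 16, 64*a^3 + 160*a^2 + 128*a + 32, 32*a^2 + 32*a + 16:] t = vamos_wronskian a t 0" for t
        by (simp add: vamos_wronskian_defs algebra_simps power2_eq_square power3_eq_cube power4_eq_xxxx)
      then show "(F k a t 0)\<^sup>2 \<le> poly [:16*a^4 + 32*a^3 + 16*a^2, 32*a^4 + 128*a^3 + 120*a^2 + 24*a, 32*a^4 + 160*a^3 + 288*a^2 + 120*a + 16, 64*a^3 + 160*a^2 + 128*a + 32, 32*a^2 + 32*a + 16:] t" for t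
        using le[OF k, of a t 0] by simp
    qed simp
    obtain m00 m01 m02 m10 m11 m12 m20 m21 m22 where F0: "F k a b 0 =
        (m00 + m01 * b + m02 * b\<^sup>2) + a * (m10 + m11 * b + m12 * b\<^sup>2) + a\<^sup>2 * (m20 + m21 * b + m22 * b\<^sup>2)" for a b
    proof
      let ?G0 = "\<lambda>a. F k a 0 0" and ?G1 = "\<lambda>a. (F k a 1 0 - F k a (- 1) 0) / 2"
        and ?G2 = "\<lambda>a. (F k a 1 0 + F k a (- 1) 0) / 2 - F k a 0 0"
      show "F k a b 0 = (?G0 0 + ?G1 0 * b + ?G2 0 * b\<^sup>2)
          + a * ((?G0 1 - ?G0 (- 1)) / 2 + (?G1 1 - ?G1 (- 1)) / 2 * b + (?G2 1 - ?G2 (- 1)) / 2 * b\<^sup>2)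
          + a\<^sup>2 * (((?G0 1 + ?G0 (- 1)) / 2 - ?G0 0) + ((?G1 1 + ?G1 (- 1)) / 2 - ?G1 0) * b
             + ((?G2 1 + ?G2 (- 1)) / 2 - ?G2 0) * b\<^sup>2)" for a b
        unfolding F0a[of a b] F0b[of 0 b] F0b[of 1 b] F0b[of "- 1" b]
        by (simp add: field_simps)
    qed
    have zeros: "F k 0 0 0 = 0" "F k (- 1) 0 0 = 0" "F k 0 (- 1) 0 = 0"
      using le[OF k, of 0 0 0] le[OF k, of "- 1" 0 0] le[OF k, of 0 "- 1" 0]
      by (simp_all add: vamos_wronskian_defs)
    have anti: "F k t (- t) (- 1) = F k 0 0 (- 1) + t * (F k 1 (- 1) (- 1) - F k 0 0 (- 1))" for t
    proof -
      have "(\<lambda>t. F k t (- t) (- 1)) t = (\<lambda>t. F k t (- t) (- 1)) 0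
          + t * ((\<lambda>t. F k t (- t) (- 1)) 1 - (\<lambda>t. F k t (- t) (- 1)) 0)"
      proof (rule affine_interpolation)
        show "\<exists>f. \<forall>t. poly f t = F k t (- t) (- 1)"
          using poly_on_linesD[OF poly[OF k], of 0 1 0 "- 1" "- 1" 0] by simp
        have "poly [:2, 0, 16:] t = vamos_wronskian t (- t) (- 1)" for t
          by (simp add: vamos_wronskian_defs algebra_simps power2_eq_square power3_eq_cube power4_eq_xxxx)
        then show "(F k t (- t) (- 1))\<^sup>2 \<le> poly [:2, 0, 16:] t" for t
          using le[OF k, of t "- t" "- 1"] by simp
      qed simp
      then show ?thesis by simp
    qed
    have F: "F k a b c = F k a b 0 + c * F1 k a b" for a b c
      unfolding F1_def by (rule affine_c[OF k])
    have coeffs: "m00 = 0" "m20 = m10" "m02 = m01"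
      using zeros unfolding F0 by simp_all
    \<comment> \<open>The coefficients of \<open>t\<^sup>2\<close> and \<open>t\<^sup>4\<close> in \<open>F k t (- t) (- 1)\<close> vanish.\<close>
    then have "n11 = m11 - m10 - m01 - m22" "m22 = 0"
      using anti[of "- 1"] anti[of 2] anti[of "- 2"] unfolding F[of _ _ "- 1"] F0 F1
      by (simp_all add: power2_eq_square)
    then show ?thesis
      unfolding F[of _ _ "-1/2"] F[of _ _ "1/2"] F[of _ _ 2] F0 F1 coeffs
      by (simp add: power2_eq_square field_simps)
  qed
  \<comment> \<open>The weights come from \<open>(x + y)\<^sup>2 \<le> 5/4 * x\<^sup>2 + 5 * y\<^sup>2\<close>; summation gives \<open>240 \<le> 190\<close>.\<close>
  have "64 * (F k (-1/2) (-1) (1/2))\<^sup>2 \<le> 5/4 * (F k (-1) (-2) 2)\<^sup>2 + 80 * (F k 0 0 (-1/2))\<^sup>2"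
    if k: "k \<in> K" for k
  proof -
    have "64 * (F k (-1/2) (-1) (1/2))\<^sup>2 = (F k (-1) (-2) 2 - 4 * F k 0 0 (-1/2))\<^sup>2"
      unfolding rel[OF k, symmetric] by (simp add: power2_eq_square)
    also have "\<dots> = 5/4 * (F k (-1) (-2) 2)\<^sup>2 + 80 * (F k 0 0 (-1/2))\<^sup>2
        - (F k (-1) (-2) 2 / 2 + 8 * F k 0 0 (-1/2))\<^sup>2"
      by (simp add: power2_eq_square algebra_simps)
    finally show ?thesis by simp
  qed
  then have "(\<Sum>k\<in>K. 64 * (F k (-1/2) (-1) (1/2))\<^sup>2) \<le>
      (\<Sum>k\<in>K. 5/4 * (F k (-1) (-2) 2)\<^sup>2 + 80 * (F k 0 0 (-1/2))\<^sup>2)"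
    by (rule sum_mono)
  then have "64 * vamos_wronskian (-1/2) (-1) (1/2) \<le>
      5/4 * vamos_wronskian (-1) (-2) 2 + 80 * vamos_wronskian 0 0 (-1/2)"
    by (simp only: sum.distrib sum_distrib_left[symmetric] sos)
  then show False
    by (simp add: vamos_wronskian_defs power_numeral_reduce)
qed

section \<open>The Bezoutian of the specialized Vamos polynomial\<close>

text \<open>The specialized Vamos polynomial in the first four variables, times a power of the fourth one.\<close>

definition vamos_mpoly :: "nat \<Rightarrow> real_mpoly" where
  "vamos_mpoly k = vamos (mvar 0) (mvar 1) (mvar 2) (mvar 3) * mvar 3 ^ k"

lemma eval_vamos_mpoly: "eval_mpoly (vamos_mpoly k) x = vamos (x $ 0) (x $ 1) (x $ 2) (x $ 3) * (x $ 3) ^ k"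
  unfolding vamos_mpoly_def vamos_def single_numeral[symmetric] eval_mpoly_simps by simp

lemma line_vamos_mpoly:
  assumes "n \<ge> 4"
  shows "line_poly (vamos_mpoly k) (e_tilde n) x =
    vamos [:x $ 0:] [:x $ 1:] [:x $ 2, 1:] [:x $ 3, 1:] * [:x $ 3, 1:] ^ k"
  unfolding vamos_mpoly_def vamos_def single_numeral[symmetric] line_poly_simps
  using assms by (simp add: e_tilde_def numeral_poly)

lemma homogeneous_vamos_mpoly:
  assumes "n \<ge> 4"
  shows "vamos_mpoly k \<in> homogeneous_mpolys n (4 + k)"
proof -
  note v = homogeneous_mpolys_mvar[of _ n]
  have cubic: "mvar i * mvar j * mvar l \<in> homogeneous_mpolys n 3" if "i < 4" "j < 4" "l < 4" for i j l
    using homogeneous_mpolys_mult[OF homogeneous_mpolys_mult[OF v v] v, of i j l] that assms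
    by (simp add: numeral_3_eq_3)
  have linear: "mvar i \<in> homogeneous_mpolys n 1" if "i < 4" for i
    using v that assms by simp
  have "(mvar 2)\<^sup>2 * (mvar 3)\<^sup>2 \<in> homogeneous_mpolys n 4"
    using homogeneous_mpolys_mult[OF homogeneous_mpolys_power homogeneous_mpolys_power, OF v v, of 2 3 2 2] assms
    by simp
  moreover have "4 * ((mvar 0 + mvar 1 + mvar 2 + mvar 3) * (mvar 0 * mvar 1 * mvar 2 + mvar 0 * mvar 1 * mvar 3
      + mvar 0 * mvar 2 * mvar 3 + mvar 1 * mvar 2 * mvar 3)) \<in> homogeneous_mpolys n (0 + (1 + 3))"
    unfolding single_numeral[symmetric]
    by (intro homogeneous_mpolys_mult homogeneous_mpolys_const homogeneous_mpolys_add cubic linear) simp_all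
  ultimately have "vamos (mvar 0) (mvar 1) (mvar 2) (mvar 3) \<in> homogeneous_mpolys n 4"
    unfolding vamos_def by (intro homogeneous_mpolys_add) simp_all
  moreover have "mvar 3 ^ k \<in> homogeneous_mpolys n k"
    using homogeneous_mpolys_power[OF v, of 3 k] assms by simp
  ultimately show ?thesis
    unfolding vamos_mpoly_def by (rule homogeneous_mpolys_mult)
qed

lemma hyperbolic_vamos_mpoly:
  assumes "n \<ge> 4"
  shows "vamos_mpoly k \<in> hyperbolic_mpolys n (4 + k) (e_tilde n)"
proof -
  have "eval_mpoly (vamos_mpoly k) (e_tilde n) > 0"
    using assms by (simp add: eval_vamos_mpoly e_tilde_def vamos_def)
  moreover have "real_rooted (line_poly (vamos_mpoly k) (e_tilde n) x)" for x
    unfolding line_vamos_mpoly[OF assms]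
    by (intro real_rooted_mult real_rooted_vamos_line real_rooted_power real_rooted_linear) simp
  ultimately show ?thesis
    using homogeneous_vamos_mpoly[OF assms] by (simp add: hyperbolic_mpolys_def real_rooted_def)
qed

lemma unit_vec_hyperbolicity_cone:
  assumes "n \<ge> 4"
  shows "unit_vec n 2 \<in> hyperbolicity_cone n (vamos_mpoly k) (e_tilde n)"
  using assms by (auto simp: hyperbolicity_cone_def eval_vamos_mpoly e_tilde_def vamos_def)

text \<open>The constant coefficient of the Bezout quotient is the Wronskian \<open>f' g - g' f\<close> at \<open>0\<close>.\<close>

lemma bezout_quotient_corner:
  "coeff (coeff (bezout_quotient f g) 0) 0 = coeff f 1 * coeff g 0 - coeff g 1 * coeff f 0"
proof -
  let ?B = "bezout_quotient f g"
  have "coeff (?B * [:- [:0, 1:], 1:]) 1 = coeff ?B 0 - [:0, 1:] * coeff ?B 1"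
    by (simp add: mult.commute[of ?B])
  moreover have "coeff (?B * [:- [:0, 1:], 1:]) 1 = [:coeff f 1:] * g - [:coeff g 1:] * f"
    unfolding bezout_quotient_mult by (simp add: coeff_map_poly mult.commute[of _ "[:_:]"])
  ultimately have "coeff (coeff ?B 0 - [:0, 1:] * coeff ?B 1) 0 = coeff ([:coeff f 1:] * g - [:coeff g 1:] * f) 0"
    by (simp only:)
  then show ?thesis by simp
qed

text \<open>The points at which the fourth coordinate is 1 and all later coordinates are 0.\<close>

definition slice :: "nat \<Rightarrow> real \<Rightarrow> real \<Rightarrow> real \<Rightarrow> real vec" where
  "slice n a b c = vec n (\<lambda>i. if i = 0 then a else if i = 1 then b else if i = 2 then c else if i = 3 then 1 else 0)"

lemma slice_carrier: "slice n a b c \<in> carrier_vec n"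
  by (simp add: slice_def)

lemma poly_on_lines_slice:
  assumes "q \<in> mpolys n"
  shows "poly_on_lines (\<lambda>a b c. eval_mpoly q (slice n a b c))"
  unfolding poly_on_lines_def
proof (intro allI)
  fix a b c a' b' c'
  let ?e = "vec n (\<lambda>i. if i = 0 then a' else if i = 1 then b' else if i = 2 then c' else 0) :: real vec"
  have "poly (line_poly q ?e (slice n a b c)) t = eval_mpoly q (slice n (a + t * a') (b + t * b') (c + t * c'))" for t
  proof -
    have "slice n a b c + t \<cdot>\<^sub>v ?e = slice n (a + t * a') (b + t * b') (c + t * c')"
      by (rule eq_vecI) (auto simp: slice_def)
    then show ?thesis
      by (simp add: poly_line_poly[OF assms _ slice_carrier])
  qed
  then show "\<exists>f. \<forall>t. poly f t = eval_mpoly q (slice n (a + t * a') (b + t * b') (c + t * c'))"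
    by blast
qed

text \<open>
  The formal directional derivative is identified through its values, which are analytic
  derivatives of the polynomial function.
\<close>

lemma line_dir_deriv_vamos_mpoly:
  assumes n: "n \<ge> 4"
  shows "line_poly (dir_deriv n (unit_vec n 2) (vamos_mpoly k)) (e_tilde n) (slice n a b c) =
    vamos_deriv [:a:] [:b:] [:c, 1:] [:1, 1:] * [:1, 1:] ^ k" (is "?l = ?r")
proof -
  let ?p = "vamos_mpoly k" and ?u = "unit_vec n 2 :: real vec"
  have p: "?p \<in> mpolys n" using homogeneous_vamos_mpoly[OF n] by (simp add: homogeneous_mpolys_def)
  have "poly ?l t = poly ?r t" for t
  proof -
    let ?x = "slice n a b c + t \<cdot>\<^sub>v e_tilde n"
    have e: "e_tilde n \<in> carrier_vec n" by (simp add: e_tilde_def)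
    have "((\<lambda>s. eval_mpoly ?p (?x + s \<cdot>\<^sub>v ?u)) has_real_derivative eval_mpoly (dir_deriv n ?u ?p) ?x) (at 0)"
      using p e slice_carrier by (intro has_derivative_dir_deriv) auto
    moreover have "(\<lambda>s. eval_mpoly ?p (?x + s \<cdot>\<^sub>v ?u)) = (\<lambda>s. vamos a b (c + t + s) (1 + t) * (1 + t) ^ k)"
      using n by (simp add: eval_vamos_mpoly slice_def e_tilde_def fun_eq_iff add.assoc)
    moreover have "((\<lambda>s. vamos a b (c + t + s) (1 + t) * (1 + t) ^ k) has_real_derivative
        vamos_deriv a b (c + t) (1 + t) * (1 + t) ^ k) (at 0)"
      unfolding vamos_def vamos_deriv_def
      by (rule derivative_eq_intros refl | simp add: power2_eq_square algebra_simps)+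
    ultimately have "eval_mpoly (dir_deriv n ?u ?p) ?x = vamos_deriv a b (c + t) (1 + t) * (1 + t) ^ k"
      using DERIV_unique by metis
    then show ?thesis
      by (simp add: poly_line_poly[OF mpolys_dir_deriv[OF p] e slice_carrier] poly_vamos_deriv)
  qed
  then show ?thesis by (simp add: poly_eq_poly_eq_iff[symmetric] fun_eq_iff)
qed

text \<open>
  On the slice the additional power contributes the factor \<open>(1 + t)\<^sup>k\<close> to both polynomials, and it
  cancels from the Wronskian at \<open>t = 0\<close>.
\<close>

lemma bezoutian_vamos_corner:
  assumes n: "n \<ge> 4" and d: "d > 0"
  shows "bezoutian n d (vamos_mpoly k) (e_tilde n) (unit_vec n 2) (slice n a b c) $$ (0, 0) =
    vamos_wronskian a b c"
proof -
  have pow0: "coeff ([:1, 1:] ^ k :: real poly) 0 = 1"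
    by (simp add: poly_0_coeff_0[symmetric])
  have coeff1: "coeff (f * g) 1 = coeff f 0 * coeff g 1 + coeff f 1 * coeff g 0" for f g :: "real poly"
    by (simp add: coeff_mult)
  have corner: "coeff (coeff (bezout_quotient (f * [:1, 1:] ^ k) (g * [:1, 1:] ^ k)) 0) 0 =
      coeff f 1 * coeff g 0 - coeff g 1 * coeff f 0" for f g :: "real poly"
    unfolding bezout_quotient_corner coeff1 by (simp add: coeff_mult_0 pow0 algebra_simps)
  have line: "line_poly (vamos_mpoly k) (e_tilde n) (slice n a b c) =
      vamos [:a:] [:b:] [:c, 1:] [:1, 1:] * [:1, 1:] ^ k"
    unfolding line_vamos_mpoly[OF n] using n by (simp add: slice_def)
  have "bezoutian n d (vamos_mpoly k) (e_tilde n) (unit_vec n 2) (slice n a b c) $$ (0, 0) =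
      coeff (vamos [:a:] [:b:] [:c, 1:] [:1, 1:]) 1 * coeff (vamos_deriv [:a:] [:b:] [:c, 1:] [:1, 1:]) 0
      - coeff (vamos_deriv [:a:] [:b:] [:c, 1:] [:1, 1:]) 1 * coeff (vamos [:a:] [:b:] [:c, 1:] [:1, 1:]) 0"
    using d by (simp add: bezoutian_def line line_dir_deriv_vamos_mpoly[OF n] corner)
  also have "\<dots> = vamos_wronskian a b c"
    unfolding vamos_line_coeffs vamos_deriv_line_coeffs vamos_wronskian_defs
    by (simp add: vamos_def vamos_deriv_def power2_eq_square power3_eq_cube power4_eq_xxxx algebra_simps)
  finally show ?thesis .
qed

theorem theorem4p14:
  fixes n d :: nat
  assumes "n \<ge> 4" and "d \<ge> 4"
  shows "\<exists>p \<in> hyperbolic_mpolys n d (e_tilde n). \<not> sos_hyperbolic n d p (e_tilde n)"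
proof (intro bexI notI)
  let ?p = "vamos_mpoly (d - 4)"
  show "?p \<in> hyperbolic_mpolys n d (e_tilde n)"
    using hyperbolic_vamos_mpoly[OF assms(1), of "d - 4"] assms(2) by simp
  assume "sos_hyperbolic n d ?p (e_tilde n)"
  then have "matrix_sos n d (bezoutian n d ?p (e_tilde n) (unit_vec n 2))"
    using unit_vec_hyperbolicity_cone[OF assms(1)] by (simp add: sos_hyperbolic_def)
  then obtain K Q where Q: "Q \<in> carrier_mat d K" "elements_mat Q \<subseteq> mpolys n"
    and sos: "\<And>x. x \<in> carrier_vec n \<Longrightarrow> bezoutian n d ?p (e_tilde n) (unit_vec n 2) x =
      map_mat (\<lambda>q. eval_mpoly q x) Q * transpose_mat (map_mat (\<lambda>q. eval_mpoly q x) Q)"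
    unfolding matrix_sos_def by blast
  define F where "F k a b c = eval_mpoly (Q $$ (0, k)) (slice n a b c)" for k a b c
  have entry: "Q $$ (0, k) \<in> mpolys n" if "k < K" for k
    using Q that assms(2) by (force simp: elements_mat_def)
  show False
  proof (rule vamos_wronskian_not_sos[of "{..<K}" F])
    show "poly_on_lines (F k)" if "k \<in> {..<K}" for k
      unfolding F_def using poly_on_lines_slice[OF entry, of k] that by simp
    show "(\<Sum>k<K. (F k a b c)\<^sup>2) = vamos_wronskian a b c" for a b c
    proof -
      have "vamos_wronskian a b c = bezoutian n d ?p (e_tilde n) (unit_vec n 2) (slice n a b c) $$ (0, 0)"
        using bezoutian_vamos_corner[OF assms(1)] assms(2) by simp
      also have "\<dots> = (\<Sum>k<K. (F k a b c)\<^sup>2)"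
        using Q(1) assms(2) unfolding sos[OF slice_carrier]
        by (simp add: scalar_prod_def F_def power2_eq_square atLeast0LessThan)
      finally show ?thesis by simp
    qed
  qed simp
qed

end
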